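(* Let $f \in \mathbb{C}[x^{\pm 1}, y^{\pm 1}]$ be a Laurent polynomial and let $\vec{v} \in \mathbb{Z}^2$ be a non-zero primitive vector. Then $f$ has a line polynomial factor in direction $\vec{v}$ (in the Laurent polynomial ring $\mathbb{C}[x^{\pm1},y^{\pm1}]$) if and only if the polynomials in the set $\mathcal{F}_{\vec{v}}(f)$ have a common factor.
   Context: For $\vec{u}=(u_1,u_2)\in\mathbb{Z}^2$ write $X^{\vec{u}} = x^{u_1}y^{u_2}$. The support of $f=\sum f_{\vec{u}}X^{\vec{u}}$ is $\mathrm{supp}(f)=\{\vec{u} : f_{\vec{u}}\neq 0\}$. A vector is primitive if its components are relatively prime. A line polynomial in (primitive) direction $\vec{v}$ is a Laurent polynomial whose support contains at least two points and is contained in $\vec{u}+\mathbb{Z}\vec{v}$ for some $\vec{u}\in\mathbb{Z}^2$. Any such line polynomial can be written uniquely as $X^{\vec{u}}(a_0 + a_1 t + \dots + a_n t^n)$ with $t = X^{\vec{v}}$, $n\ge 1$, $a_0\neq 0$, $a_n \neq 0$; the one-variable proper polynomial $a_0+a_1t+\dots+a_nt^n\in\mathbb{C}[t]$ is its normal form. The normal form of a monomial $aX^{\vec{u}}$ ($a\neq0$) is the constant $a$. A $\vec{v}$-fiber of $f$ is a polynomial of the form $\sum_{k\in\mathbb{Z}} f_{\vec{u}+k\vec{v}}X^{\vec{u}+k\vec{v}}$ for some $\vec{u}\in\mathbb{Z}^2$. $\mathcal{F}_{\vec{v}}(f)$ denotes the (finite) set of normal forms of all non-zero $\vec{v}$-fibers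 of $f$. Polynomials "have a common factor" if they have a common non-unit factor (in $\mathbb{C}[t]$). *)

theory Defs
  imports
    "HOL-Library.Poly_Mapping"
    "HOL-Library.Product_Plus"
    "HOL-Computational_Algebra.Polynomial"
    Complex_Main
begin

text \<open>
  A Laurent polynomial in \<open>x\<close>, \<open>y\<close> is a finitely supported function from exponent vectors to
  coefficients; multiplication on this type is convolution, and \<open>Poly_Mapping.keys\<close> is the support.
\<close>

type_synonym laurent = "(int \<times> int) \<Rightarrow>\<^sub>0 complex"

definition X :: "int \<times> int \<Rightarrow> laurent"
  where "X u = Poly_Mapping.single u 1"

definition primitive :: "int \<times> int \<Rightarrow> bool"
  where "primitive v \<longleftrightarrow> coprime (fst v) (snd v)"

definition vscale :: "int \<Rightarrow> int \<times> int \<Rightarrow> int \<times> int"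
  where "vscale k v = (k * fst v, k * snd v)"

definition line :: "int \<times> int \<Rightarrow> int \<times> int \<Rightarrow> (int \<times> int) set"
  where "line v u = {u + vscale k v | k. True}"

definition line_poly :: "int \<times> int \<Rightarrow> laurent \<Rightarrow> bool"
  where "line_poly v g \<longleftrightarrow>
    2 \<le> card (Poly_Mapping.keys g) \<and> (\<exists>u. Poly_Mapping.keys g \<subseteq> line v u)"

definition fiber :: "int \<times> int \<Rightarrow> int \<times> int \<Rightarrow> laurent \<Rightarrow> laurent"
  where "fiber v u f =
    (\<Sum>w \<in> Poly_Mapping.keys f \<inter> line v u. Poly_Mapping.single w (Poly_Mapping.lookup f w))"

text \<open>The Laurent polynomial \<open>a\<^sub>0 + a\<^sub>1 t + \<dots> + a\<^sub>n t\<^sup>n\<close> with \<open>t = X v\<close>;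
  \<open>Poly_Mapping.single 0\<close> embeds the constants.\<close>

definition subst_dir :: "int \<times> int \<Rightarrow> complex poly \<Rightarrow> laurent"
  where "subst_dir v p = poly (map_poly (Poly_Mapping.single 0) p) (X v)"

text \<open>
  The condition \<open>coeff p 0 \<noteq> 0\<close> also forces \<open>p \<noteq> 0\<close>, hence a non-zero leading coefficient.
  The case \<open>degree p = 0\<close> is the normal form of a monomial. The description is only meaningful
  for non-zero \<open>g\<close> supported on a line in direction \<open>v\<close>, see \<open>normal_form_ex1\<close> below.
\<close>

definition normal_form :: "int \<times> int \<Rightarrow> laurent \<Rightarrow> complex poly"
  where "normal_form v g = (THE p. coeff p 0 \<noteq> 0 \<and> (\<exists>u. g = X u * subst_dir v p))"

definition fiber_normal_forms :: "int \<times> int \<Rightarrow> laurent \<Rightarrow> complex poly set"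
  where "fiber_normal_forms v f = {normal_form v (fiber v u f) | u. fiber v u f \<noteq> 0}"

definition have_common_factor :: "complex poly set \<Rightarrow> bool"
  where "have_common_factor P \<longleftrightarrow> (\<exists>d. \<not> is_unit d \<and> (\<forall>p \<in> P. d dvd p))"

lemma X_power: "X v ^ i = X (vscale (int i) v)"
  by (induction i) (simp_all add: X_def vscale_def mult_single algebra_simps
        zero_prod_def plus_prod_def flip: single_one)

lemma X_mult_subst_dir:
  "X u * subst_dir v p =
    (\<Sum>i\<le>degree p. Poly_Mapping.single (u + vscale (int i) v) (coeff p i))"
proof -
  have deg: "degree (map_poly (Poly_Mapping.single (0::int \<times> int)) p) = degree p"
    by (rule degree_map_poly) (metis lookup_single_eq lookup_zero)
  show ?thesis
    unfolding subst_dir_def poly_altdef deg X_power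
    by (simp add: coeff_map_poly sum_distrib_left X_def mult_single)
qed

lemma vscale_inject: "v \<noteq> 0 \<Longrightarrow> u + vscale k v = u + vscale l v \<longleftrightarrow> k = l"
  by (cases v) (auto simp: vscale_def zero_prod_def)

lemma vscale_add: "u + vscale k v + vscale l v = u + vscale (k + l) v"
  by (cases u) (simp add: vscale_def algebra_simps)

lemma lookup_X_mult_subst_dir:
  assumes "v \<noteq> 0"
  shows "Poly_Mapping.lookup (X u * subst_dir v p) (u + vscale k v) =
    (if k \<ge> 0 then coeff p (nat k) else 0)"
proof -
  have "Poly_Mapping.lookup (X u * subst_dir v p) (u + vscale k v) =
      (\<Sum>i\<le>degree p. if int i = k then coeff p i else 0)"
    by (simp add: X_mult_subst_dir lookup_sum lookup_single when_def vscale_inject[OF assms]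
        del: add_left_cancel)
  also have "\<dots> = (\<Sum>i\<le>degree p. if k \<ge> 0 \<and> nat k = i then coeff p i else 0)"
    by (intro sum.cong) auto
  also have "\<dots> = (if k \<ge> 0 then coeff p (nat k) else 0)"
    by (auto simp: coeff_eq_0)
  finally show ?thesis .
qed

lemma lookup_X_mult_subst_dir_outside:
  "w \<notin> line v u \<Longrightarrow> Poly_Mapping.lookup (X u * subst_dir v p) w = 0"
  by (auto simp: X_mult_subst_dir lookup_sum lookup_single when_def line_def intro!: sum.neutral)

lemma normal_form_ex1:
  assumes v: "v \<noteq> 0" and g: "g \<noteq> 0" and line: "Poly_Mapping.keys g \<subseteq> line v u"
  shows "\<exists>!p. coeff p 0 \<noteq> 0 \<and> (\<exists>u. g = X u * subst_dir v p)"
proof (rule ex_ex1I)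
  define c where "c k = Poly_Mapping.lookup g (u + vscale k v)" for k
  define K where "K = {k. c k \<noteq> 0}"
  have "finite ((\<lambda>k. u + vscale k v) -` Poly_Mapping.keys g)"
    by (rule finite_vimageI) (auto intro!: injI simp: vscale_inject[OF v] simp del: add_left_cancel)
  moreover have "(\<lambda>k. u + vscale k v) -` Poly_Mapping.keys g = K"
    by (auto simp: K_def c_def in_keys_iff)
  ultimately have fin: "finite K" by simp
  obtain w where w: "w \<in> Poly_Mapping.keys g" using g by (metis ex_in_conv keys_eq_empty)
  then obtain k where "w = u + vscale k v" using line by (auto simp: line_def)
  with w have ne: "K \<noteq> {}" by (auto simp: K_def c_def in_keys_iff)
  define m where "m = Min K"
  have m: "m \<in> K" "\<And>k. k \<in> K \<Longrightarrow> m \<le> k" using fin ne by (auto simp: m_def)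
  define p where "p = (\<Sum>k\<in>K. monom (c k) (nat (k - m)))"
  have p: "coeff p i = c (m + int i)" for i
  proof -
    have "coeff p i = (\<Sum>k\<in>K. if k = m + int i then c k else 0)"
      unfolding p_def coeff_sum using m by (intro sum.cong) auto
    also have "\<dots> = c (m + int i)" using fin by (auto simp: K_def)
    finally show ?thesis .
  qed
  have "Poly_Mapping.lookup g w = Poly_Mapping.lookup (X (u + vscale m v) * subst_dir v p) w" for w
  proof (cases "w \<in> line v (u + vscale m v)")
    case True
    then obtain k where k: "w = u + vscale m v + vscale k v" by (auto simp: line_def)
    have "c (m + k) = 0" if "k < 0" using m(2)[of "m + k"] that by (auto simp: K_def)
    then show ?thesis
      unfolding k lookup_X_mult_subst_dir[OF v] by (auto simp: p vscale_add c_def)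
  next
    case False
    have "w \<notin> line v u"
    proof
      assume "w \<in> line v u"
      then obtain k where "w = u + vscale k v" by (auto simp: line_def)
      then have "w = u + vscale m v + vscale (k - m) v" by (simp add: vscale_add)
      with False show False by (auto simp: line_def)
    qed
    with line have "Poly_Mapping.lookup g w = 0" by (auto simp: in_keys_iff)
    then show ?thesis using False by (simp add: lookup_X_mult_subst_dir_outside)
  qed
  then have "g = X (u + vscale m v) * subst_dir v p" by (intro poly_mapping_eqI)
  moreover have "coeff p 0 \<noteq> 0" using m(1) by (simp add: p K_def)
  ultimately show "\<exists>p. coeff p 0 \<noteq> 0 \<and> (\<exists>u. g = X u * subst_dir v p)" by blast
next
  have base: "\<exists>k\<ge>0. a = b + vscale k v"
    if "g = X a * subst_dir v p" "coeff p 0 \<noteq> 0" "g = X b * subst_dir v q" for a b p q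
  proof -
    have "Poly_Mapping.lookup g (a + vscale 0 v) \<noteq> 0"
      using that(2) unfolding that(1) lookup_X_mult_subst_dir[OF v] by simp
    then have nz: "Poly_Mapping.lookup g a \<noteq> 0" by (simp add: vscale_def flip: zero_prod_def)
    then have "a \<in> line v b" using that(3) lookup_X_mult_subst_dir_outside by blast
    then obtain k where k: "a = b + vscale k v" by (auto simp: line_def)
    moreover have "k \<ge> 0"
      using nz unfolding that(3) k lookup_X_mult_subst_dir[OF v] by (auto split: if_splits)
    ultimately show ?thesis by blast
  qed
  fix p q
  assume "coeff p 0 \<noteq> 0 \<and> (\<exists>u. g = X u * subst_dir v p)"
    and "coeff q 0 \<noteq> 0 \<and> (\<exists>u. g = X u * subst_dir v q)"
  then obtain a b where p: "coeff p 0 \<noteq> 0" "g = X a * subst_dir v p"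
    and q: "coeff q 0 \<noteq> 0" "g = X b * subst_dir v q" by blast
  obtain k where k: "k \<ge> 0" "a = b + vscale k v" using base[OF p(2,1) q(2)] by blast
  obtain l where l: "l \<ge> 0" "b = a + vscale l v" using base[OF q(2,1) p(2)] by blast
  have "b + vscale (k + l) v = b + vscale 0 v"
    using k(2) l(2) vscale_add[of b k v l] by (simp add: vscale_def flip: zero_prod_def)
  then have "k + l = 0" using vscale_inject[OF v] by blast
  with k(1) l(1) have "k = 0" by simp
  with k(2) have ab: "a = b" by (simp add: vscale_def flip: zero_prod_def)
  show "p = q"
  proof (rule poly_eqI)
    fix i
    show "coeff p i = coeff q i"
      using lookup_X_mult_subst_dir[OF v, of a p "int i"]
        lookup_X_mult_subst_dir[OF v, of a q "int i"] p(2) q(2) ab by simp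
  qed
qed

lemma lookup_fiber:
  "Poly_Mapping.lookup (fiber v u f) w = (if w \<in> line v u then Poly_Mapping.lookup f w else 0)"
  by (auto simp: fiber_def lookup_sum lookup_single when_def in_keys_iff)

lemma keys_fiber: "Poly_Mapping.keys (fiber v u f) = Poly_Mapping.keys f \<inter> line v u"
  by (auto simp: in_keys_iff lookup_fiber split: if_splits)

end

theory Submission imports Defs begin

text \<open>
  The \<open>v\<close>-fibers of \<open>f\<close> sum up to \<open>f\<close>, and multiplication by a Laurent polynomial supported on
  a line in direction \<open>v\<close> merely permutes the fibers: the fiber of \<open>g * h\<close> is \<open>g\<close> times a fiber
  of \<open>h\<close>. So \<open>g\<close> divides \<open>f\<close> iff it divides every fiber of \<open>f\<close>, and for Laurent polynomials on a
  single line divisibility is that of the normal forms.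
\<close>

lemma self_in_line: "u \<in> line v u"
  by (auto simp: line_def vscale_def zero_prod_def[symmetric] intro!: exI[of _ 0])

lemma mem_line_iff: "w \<in> line v u \<longleftrightarrow> (\<exists>k. w - u = vscale k v)"
  by (auto simp: line_def algebra_simps)

lemma vscale_plus: "vscale (k + l) v = vscale k v + vscale l v"
  by (simp add: vscale_def algebra_simps)

lemma vscale_minus: "vscale (k - l) v = vscale k v - vscale l v"
  by (simp add: vscale_def algebra_simps)

lemma line_add:
  assumes "a \<in> line v s" "b \<in> line v t"
  shows "a + b \<in> line v (s + t)"
proof -
  from assms obtain k l where "a - s = vscale k v" "b - t = vscale l v"
    by (metis mem_line_iff)
  moreover have "a + b - (s + t) = (a - s) + (b - t)" by simp
  ultimately have "a + b - (s + t) = vscale (k + l) v" by (simp only: vscale_plus)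
  then show ?thesis unfolding mem_line_iff by blast
qed

lemma line_diff:
  assumes "a \<in> line v s" "b \<in> line v t"
  shows "a - b \<in> line v (s - t)"
proof -
  from assms obtain k l where "a - s = vscale k v" "b - t = vscale l v"
    by (metis mem_line_iff)
  moreover have "a - b - (s - t) = (a - s) - (b - t)" by simp
  ultimately have "a - b - (s - t) = vscale (k - l) v" by (simp only: vscale_minus)
  then show ?thesis unfolding mem_line_iff by blast
qed

text \<open>Lines in direction \<open>v\<close> are the cosets of the subgroup of multiples of
  \<open>v\<close>, so they partition the plane. This lets the support of \<open>f\<close> be
  grouped by lines.\<close>

lemma line_eq_iff: "line v w = line v u \<longleftrightarrow> w \<in> line v u"
proof
  assume w: "w \<in> line v u"
  show "line v w = line v u"
  proof (intro equalityI subsetI)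
    fix x assume "x \<in> line v w"
    from line_diff[OF line_add[OF this w] self_in_line, of w] show "x \<in> line v u" by simp
  next
    fix x assume "x \<in> line v u"
    from line_diff[OF line_add[OF this self_in_line] w, of w] show "x \<in> line v w" by simp
  qed
qed (use self_in_line in blast)

text \<open>Each support point lies on exactly one line. The sum runs over lines, not base points,
  because all base points on a line give the same fiber; \<open>SOME\<close> merely picks one of
  them.\<close>

lemma sum_fibers: "(\<Sum>L\<in>line v ` Poly_Mapping.keys f. fiber v (SOME u. line v u = L) f) = f"
proof -
  have "fiber v (SOME u. line v u = L) f =
      (\<Sum>w\<in>{x \<in> Poly_Mapping.keys f. line v x = L}.
        Poly_Mapping.single w (Poly_Mapping.lookup f w))"
    if "L \<in> line v ` Poly_Mapping.keys f" for L
  proof -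
    define r where "r = (SOME u. line v u = L)"
    from that have L: "line v r = L" unfolding r_def by (metis (mono_tags) imageE someI)
    have "Poly_Mapping.keys f \<inter> line v r = {x \<in> Poly_Mapping.keys f. line v x = L}"
      unfolding L[symmetric] line_eq_iff by blast
    then show ?thesis unfolding fiber_def r_def[symmetric] by (rule sum.cong) simp
  qed
  then have "(\<Sum>L\<in>line v ` Poly_Mapping.keys f. fiber v (SOME u. line v u = L) f) =
      (\<Sum>w\<in>Poly_Mapping.keys f. Poly_Mapping.single w (Poly_Mapping.lookup f w))"
    unfolding sum.image_gen[OF finite_keys, where g = "line v"] by (intro sum.cong refl)
  also have "\<dots> = f"
    by (intro poly_mapping_eqI) (auto simp: lookup_sum lookup_single when_def in_keys_iff)
  finally show ?thesis .
qed

text \<open>Split \<open>h\<close> into its fiber through \<open>t\<close> and the remainder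
  \<open>h'\<close>. Multiplying by \<open>g\<close> shifts lines by the class of \<open>s\<close>,
  so the first product stays on the line through \<open>s + t\<close> and the second avoids
  it.\<close>

lemma fiber_mult:
  assumes "Poly_Mapping.keys g \<subseteq> line v s"
  shows "fiber v (s + t) (g * h) = g * fiber v t h"
proof (rule poly_mapping_eqI)
  fix w
  define h' where "h' = h - fiber v t h"
  have gh: "g * h = g * fiber v t h + g * h'" by (simp add: h'_def algebra_simps)
  have in_line: "w \<in> line v (s + t)" if "Poly_Mapping.lookup (g * fiber v t h) w \<noteq> 0"
  proof -
    from that have "w \<in> Poly_Mapping.keys (g * fiber v t h)" by (simp add: in_keys_iff)
    then obtain a b where "w = a + b" "a \<in> Poly_Mapping.keys g" "b \<in> line v t"
      using keys_mult[of g "fiber v t h"] by (auto simp: keys_fiber)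
    with assms show ?thesis by (auto intro: line_add)
  qed
  have off_line: "w \<notin> line v (s + t)" if "Poly_Mapping.lookup (g * h') w \<noteq> 0"
  proof -
    from that have "w \<in> Poly_Mapping.keys (g * h')" by (simp add: in_keys_iff)
    then obtain a b where "w = a + b" "a \<in> Poly_Mapping.keys g" "b \<in> Poly_Mapping.keys h'"
      using keys_mult[of g h'] by auto
    moreover from this have "b \<notin> line v t"
      by (auto simp: h'_def in_keys_iff lookup_minus lookup_fiber)
    \<comment> \<open>If \<open>w = a + b\<close> were on the line through \<open>s + t\<close>,
      subtracting \<open>a\<close> would put \<open>b\<close> on the line through
      \<open>t\<close>.\<close>
    ultimately show ?thesis using assms line_diff[of w v "s + t" a s] by auto
  qed
  show "Poly_Mapping.lookup (fiber v (s + t) (g * h)) w = Poly_Mapping.lookup (g * fiber v t h) w"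
    using in_line off_line by (auto simp: lookup_fiber gh lookup_add)
qed

lemma subst_dir_pCons:
  "subst_dir v (pCons a p) = Poly_Mapping.single 0 a + X v * subst_dir v p"
  by (simp add: subst_dir_def map_poly_pCons)

lemma subst_dir_0 [simp]: "subst_dir v 0 = 0"
  by (simp add: subst_dir_def)

lemma subst_dir_add: "subst_dir v (p + q) = subst_dir v p + subst_dir v q"
  by (induction p q rule: poly_induct2) (simp_all add: subst_dir_pCons single_add algebra_simps)

lemma subst_dir_smult: "subst_dir v (smult a p) = Poly_Mapping.single 0 a * subst_dir v p"
  by (induction p) (simp_all add: subst_dir_pCons mult_single algebra_simps)

text \<open>Evaluation at \<open>X v\<close> is a ring homomorphism, so factorizations in one
  variable carry over to Laurent polynomials.\<close>

lemma subst_dir_mult: "subst_dir v (p * q) = subst_dir v p * subst_dir v q"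
  by (induction p)
    (simp_all add: subst_dir_pCons subst_dir_add subst_dir_smult algebra_simps)

lemma X_add: "X (a + b) = X a * X b"
  by (simp add: X_def mult_single)

lemma X_0: "X 0 = 1"
  by (simp add: X_def)

lemma keys_X_mult_subst_dir: "Poly_Mapping.keys (X u * subst_dir v p) \<subseteq> line v u"
proof
  fix w assume "w \<in> Poly_Mapping.keys (X u * subst_dir v p)"
  then have "Poly_Mapping.lookup (X u * subst_dir v p) w \<noteq> 0" unfolding in_keys_iff .
  then show "w \<in> line v u" by (rule contrapos_np) (rule lookup_X_mult_subst_dir_outside)
qed

text \<open>Uniqueness of the normal form applies because the representation itself makes
  \<open>g\<close> non-zero, with coefficient \<open>coeff p 0\<close> at \<open>u\<close>, and
  supported on a line.\<close>

lemma normal_form_eqI: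
  assumes "v \<noteq> 0" "coeff p 0 \<noteq> 0" "g = X u * subst_dir v p"
  shows "normal_form v g = p"
proof -
  have "Poly_Mapping.lookup g (u + vscale 0 v) \<noteq> 0"
    unfolding assms(3) lookup_X_mult_subst_dir[OF assms(1)] using assms(2) by simp
  then have "g \<noteq> 0" by auto
  moreover have "Poly_Mapping.keys g \<subseteq> line v u"
    unfolding assms(3) by (rule keys_X_mult_subst_dir)
  ultimately have "\<exists>!p. coeff p 0 \<noteq> 0 \<and> (\<exists>u. g = X u * subst_dir v p)"
    using assms(1) normal_form_ex1 by blast
  then show ?thesis
    unfolding normal_form_def by (rule the1_equality) (use assms in blast)
qed

lemma normal_form_obtain:
  assumes "v \<noteq> 0" "g \<noteq> 0" "Poly_Mapping.keys g \<subseteq> line v u"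
  obtains a where "coeff (normal_form v g) 0 \<noteq> 0" "g = X a * subst_dir v (normal_form v g)"
  using theI'[OF normal_form_ex1[OF assms]] unfolding normal_form_def by blast

lemma line_poly_X_mult_subst_dir:
  assumes "v \<noteq> 0" "coeff p 0 \<noteq> 0"
  shows "line_poly v (X u * subst_dir v p) \<longleftrightarrow> degree p \<noteq> 0"
proof -
  let ?g = "X u * subst_dir v p"
  show ?thesis
  proof
    assume "line_poly v ?g"
    then have card: "2 \<le> card (Poly_Mapping.keys ?g)" by (simp add: line_poly_def)
    show "degree p \<noteq> 0"
    proof
      assume "degree p = 0"
      then have "Poly_Mapping.keys ?g \<subseteq> {u + vscale 0 v}"
        by (auto simp: X_mult_subst_dir)
      from card_mono[OF _ this] card show False by simp
    qed
  next
    assume deg: "degree p \<noteq> 0"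
    \<comment> \<open>The two ends of the support carry the constant and the leading coefficient;
      they are distinct points since \<open>v\<close> is non-zero.\<close>
    have "{u + vscale 0 v, u + vscale (int (degree p)) v} \<subseteq> Poly_Mapping.keys ?g"
      using assms deg by (auto simp: in_keys_iff lookup_X_mult_subst_dir simp del: add_left_cancel)
    from card_mono[OF _ this] have "2 \<le> card (Poly_Mapping.keys ?g)"
      using deg vscale_inject[OF assms(1), of u 0 "int (degree p)"] by simp
    then show "line_poly v ?g" using keys_X_mult_subst_dir line_poly_def by blast
  qed
qed

text \<open>The common factor is the normal form of \<open>g\<close>: every fiber of
  \<open>f\<close> is \<open>g\<close> times a fiber of the cofactor, and normal forms
  multiply.\<close>

lemma line_factor_imp_common_factor:
  assumes v: "v \<noteq> 0" and g: "line_poly v g" "g dvd f"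
  shows "have_common_factor (fiber_normal_forms v f)"
proof -
  from g obtain s h where s: "Poly_Mapping.keys g \<subseteq> line v s" and f: "f = g * h"
    by (auto simp: line_poly_def)
  from g(1) have "g \<noteq> 0" by (auto simp: line_poly_def)
  then obtain a where d: "coeff (normal_form v g) 0 \<noteq> 0" "g = X a * subst_dir v (normal_form v g)"
    using v s normal_form_obtain by blast
  define d where "d = normal_form v g"
  have "degree d \<noteq> 0"
    using line_poly_X_mult_subst_dir[OF v d(1), of a] d(2) g(1) by (simp add: d_def)
  then have "\<not> is_unit d" by (metis degree_0 is_unit_iff_degree)
  moreover have "d dvd p" if p: "p \<in> fiber_normal_forms v f" for p
  proof -
    from p obtain u where u: "p = normal_form v (fiber v u f)" "fiber v u f \<noteq> 0"
      by (auto simp: fiber_normal_forms_def)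
    have fib: "fiber v u f = g * fiber v (u - s) h"
      using fiber_mult[OF s, of "u - s" h] by (simp add: f)
    with u(2) have "fiber v (u - s) h \<noteq> 0" by auto
    then obtain b where q: "coeff (normal_form v (fiber v (u - s) h)) 0 \<noteq> 0"
      "fiber v (u - s) h = X b * subst_dir v (normal_form v (fiber v (u - s) h))"
      using normal_form_obtain[OF v, of "fiber v (u - s) h" "u - s"] by (auto simp: keys_fiber)
    define q where "q = normal_form v (fiber v (u - s) h)"
    have "fiber v u f = (X a * subst_dir v d) * (X b * subst_dir v q)"
      using fib d(2) q(2) by (simp add: d_def q_def)
    also have "\<dots> = X (a + b) * subst_dir v (d * q)"
      by (simp add: X_add subst_dir_mult ac_simps)
    \<comment> \<open>The constant term of \<open>d * q\<close> is a product of non-zero numbers, so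
      \<open>d * q\<close> is a normal form.\<close>
    finally have "p = d * q"
      unfolding u(1) using d(1) q(1)
      by (intro normal_form_eqI[OF v]) (simp_all add: d_def q_def coeff_mult_0)
    then show ?thesis by simp
  qed
  ultimately show ?thesis by (auto simp: have_common_factor_def)
qed

text \<open>For non-zero \<open>f\<close>, the line factor is the common factor \<open>d\<close>
  evaluated at \<open>X v\<close>.\<close>

lemma common_factor_imp_line_factor:
  assumes v: "v \<noteq> 0" and "have_common_factor (fiber_normal_forms v f)"
  shows "\<exists>g. line_poly v g \<and> g dvd f"
proof (cases "f = 0")
  case True
  \<comment> \<open>Here there are no non-zero fibers, so the hypothesis says nothing about
    \<open>d\<close>, which could even be 0. Any line polynomial divides 0; take
    \<open>1 + X v\<close>.\<close>
  have "line_poly v (X 0 * subst_dir v [:1, 1:])"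
    using line_poly_X_mult_subst_dir[OF v, of "[:1, 1:]" 0] by simp
  with True show ?thesis by auto
next
  case False
  from assms obtain d where unit: "\<not> is_unit d" and d: "\<And>p. p \<in> fiber_normal_forms v f \<Longrightarrow> d dvd p"
    by (auto simp: have_common_factor_def)
  have nf: "coeff (normal_form v (fiber v u f)) 0 \<noteq> 0 \<and> d dvd normal_form v (fiber v u f) \<and>
      (\<exists>a. fiber v u f = X a * subst_dir v (normal_form v (fiber v u f)))"
    if "fiber v u f \<noteq> 0" for u
  proof -
    have "normal_form v (fiber v u f) \<in> fiber_normal_forms v f"
      unfolding fiber_normal_forms_def using that by blast
    then have "d dvd normal_form v (fiber v u f)" by (rule d)
    moreover have "Poly_Mapping.keys (fiber v u f) \<subseteq> line v u"
      by (simp add: keys_fiber)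
    ultimately show ?thesis
      using normal_form_obtain[OF v that] by blast
  qed
  obtain u where "fiber v u f \<noteq> 0" using False sum_fibers[of v f] by (metis sum.neutral)
  \<comment> \<open>A power of the variable is a non-unit in one variable but becomes a unit under
    evaluation at \<open>X v\<close>. Such a \<open>d\<close> is excluded, as it divides a
    polynomial with non-zero constant term.\<close>
  then have "coeff d 0 \<noteq> 0" using nf[of u] by (auto simp: coeff_mult_0 elim!: dvdE)
  moreover from this unit have "degree d \<noteq> 0" by (metis coeff_0 is_unit_iff_degree)
  ultimately have "line_poly v (subst_dir v d)"
    using line_poly_X_mult_subst_dir[OF v, of d 0] by (simp add: X_0)
  moreover have "subst_dir v d dvd fiber v u f" for u
  proof (cases "fiber v u f = 0")
    case False
    then obtain q a where "fiber v u f = X a * subst_dir v (d * q)"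
      using nf[of u] by (metis dvdE)
    then show ?thesis by (simp add: subst_dir_mult)
  qed simp
  then have "subst_dir v d dvd f" by (metis sum_fibers dvd_sum)
  ultimately show ?thesis by blast
qed

theorem theorem5:
  fixes f :: laurent and v :: "int \<times> int"
  assumes "v \<noteq> 0" and "primitive v"
  shows "(\<exists>g. line_poly v g \<and> g dvd f) \<longleftrightarrow> have_common_factor (fiber_normal_forms v f)"
proof
  assume "\<exists>g. line_poly v g \<and> g dvd f"
  then show "have_common_factor (fiber_normal_forms v f)"
    by (elim exE conjE) (rule line_factor_imp_common_factor[OF assms(1)])
qed (rule common_factor_imp_line_factor[OF assms(1)])

end
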